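(* For any $\mathbf{a}\in\mathbf{Z}^r$ ($r\geqslant0$), there exists a unique finitely supported family $(f_{\mathbf{b}})_{\mathbf{b}\in\mathscr{C}}$ of polynomials $f_{\mathbf{b}}\in\mathbf{Q}[T]$ such that for each $n\in\mathbf{N}$, $$\sigma(\mathbf{a})_n=\sum_{\mathbf{b}\in\mathscr{C}}f_{\mathbf{b}}(n)\,\sigma(\mathbf{b})_n.$$
   Context: $\mathscr{C}$ is the set of all compositions, i.e. finite sequences (possibly empty) of positive integers. For $r\geqslant1$, $\mathbf{s}=(s_1,\ldots,s_r)\in\mathbf{C}^r$ and $n\in\mathbf{N}$, $\sigma(\mathbf{s})_n=\sum_{n_1>\cdots>n_r>n}\binom{2n_1}{n_1}^{-1}n_1^{-s_1}\cdots n_r^{-s_r}$ (absolutely convergent), and for $r=0$, $\sigma(\varnothing)_n=\binom{2n}{n}^{-1}$. *)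

theory Defs
  imports "HOL-Analysis.Analysis" "HOL-Computational_Algebra.Polynomial"
begin

definition compositions :: "nat list set" where
  "compositions = {b. \<forall>x\<in>set b. 0 < x}"

text \<open>
  The index set consists of the lists \<open>[n\<^sub>1, \<dots>, n\<^sub>r]\<close> with \<open>n\<^sub>1 > \<dots> > n\<^sub>r > n\<close>.  All entries are
  positive, so the value of \<open>powr\<close> at \<open>0\<close> plays no role.
\<close>

definition decr_above :: "nat \<Rightarrow> nat \<Rightarrow> nat list set" where
  "decr_above r n = {ns. length ns = r \<and> sorted_wrt (>) (ns @ [n])}"

definition cb_sigma :: "complex list \<Rightarrow> nat \<Rightarrow> complex" where
  "cb_sigma s n =
     (if s = [] then inverse (of_nat ((2 * n) choose n))
      else (\<Sum>\<^sub>\<infinity>ns\<in>decr_above (length s) n.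
              inverse (of_nat ((2 * hd ns) choose (hd ns))) *
              (\<Prod>i<length s. of_nat (ns ! i) powr (- (s ! i)))))"

end

theory Submission
  imports Defs "HOL-Computational_Algebra.Field_as_Ring"
    "HOL-Computational_Algebra.Polynomial_Factorial"
    "HOL-Computational_Algebra.Fundamental_Theorem_Algebra"
begin

text \<open>
  Reading an index list from its last entry gives the recursion
  \<open>\<sigma>(s\<^sub>1, \<dots>, s\<^sub>r)\<^sub>n = \<Sum>m>n. m powi (-s\<^sub>r) * \<sigma>(s\<^sub>1, \<dots>, s\<^sub>r\<^sub>-\<^sub>1)\<^sub>m\<close>, so index lists are
  reversed throughout.

  Existence: it suffices that tail sums \<open>\<Sum>m>n. m^k * \<sigma>(b)\<^sub>m\<close> with \<open>k \<ge> 0\<close> and \<open>b\<close> a composition stay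
  in the \<open>\<rat>[n]\<close>-module spanned by the \<open>\<sigma>(c)\<close>. For \<open>b \<noteq> \<emptyset>\<close> this is summation by parts and induction
  on the length of \<open>b\<close>; for \<open>b = \<emptyset>\<close> one telescopes \<open>P(m) * \<sigma>(\<emptyset>)\<^sub>m\<close> using
  \<open>m * \<sigma>(\<emptyset>)\<^sub>m\<^sub>-\<^sub>1 = (4 * m - 2) * \<sigma>(\<emptyset>)\<^sub>m\<close>.

  Uniqueness: in a nontrivial relation over a suffix-closed set of compositions let \<open>F\<close> be the
  coefficient of a longest one. Then \<open>F(n)\<close> times the relation at \<open>n - 1\<close> minus \<open>F(n - 1)\<close> times the
  relation at \<open>n\<close> is a relation with fewer terms, hence trivial. Its coefficients say that a rational
  function \<open>h\<close> solves \<open>h(x) = a(x) * h(x - 1) + k(1 / x)\<close> with \<open>a = 1\<close> or \<open>a = 4 - 2 / x\<close> and a nonzero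
  polynomial \<open>k\<close> without constant term. Comparing poles shows that \<open>h\<close> is a polynomial, and comparing
  degrees then gives a contradiction.
\<close>

subsection \<open>Polynomial and rational difference equations\<close>

definition shift :: "complex poly \<Rightarrow> complex poly" where
  "shift p = pcompose p [:-1, 1:]"

lemma poly_shift [simp]: "poly (shift p) x = poly p (x - 1)"
  by (simp add: shift_def poly_pcompose algebra_simps)

lemma shift_mult [simp]: "shift (p * q) = shift p * shift q"
  by (simp add: shift_def pcompose_mult)

lemma shift_smult [simp]: "shift (smult c p) = smult c (shift p)"
  by (simp add: shift_def pcompose_smult)

lemma shift_eq_0_iff [simp]: "shift p = 0 \<longleftrightarrow> p = 0"
  by (simp add: shift_def pcompose_eq_0_iff)

lemma degree_shift [simp]: "degree (shift p) = degree p"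
  by (simp add: shift_def degree_pcompose)

lemma lead_coeff_shift [simp]: "coeff (shift p) (degree p) = lead_coeff p"
  using lead_coeff_comp[of "[:-1, 1:]" p] by (simp add: shift_def degree_pcompose)

lemma poly_zero_if_eventually_zero:
  fixes p :: "complex poly"
  assumes "\<forall>n\<ge>N. poly p (of_nat n) = 0"
  shows "p = 0"
proof (rule ccontr)
  assume "p \<noteq> 0"
  then have "finite {x. poly p x = 0}"
    by (rule poly_roots_finite)
  moreover have "of_nat ` {N..} \<subseteq> {x. poly p x = 0}"
    using assms by auto
  ultimately have "finite ((of_nat :: nat \<Rightarrow> complex) ` {N..})"
    using finite_subset by blast
  then show False
    by (simp add: finite_image_iff inj_on_def infinite_Ici)
qed

lemma poly_nonzero_eventually:
  fixes p :: "complex poly"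
  assumes "p \<noteq> 0"
  obtains N where "\<And>n. n \<ge> N \<Longrightarrow> poly p (of_nat n) \<noteq> 0"
proof -
  have "finite {n::nat. poly p (of_nat n) = 0}"
    using finite_vimageI[OF poly_roots_finite[OF assms], of "of_nat :: nat \<Rightarrow> complex"]
    by (simp add: vimage_def inj_on_def)
  then obtain N where "\<forall>n\<in>{n::nat. poly p (of_nat n) = 0}. n < N"
    using finite_nat_set_iff_bounded by auto
  then show ?thesis
    by (intro that[of N]) force
qed

text \<open>The quotient \<open>g / F\<close> has period 1, so it is constant along the naturals
  past the last natural root of \<open>F\<close>; agreement of polynomials at infinitely many points
  is then global.\<close>

lemma proportional_if_shift_proportional:
  assumes "F \<noteq> 0" and eq: "F * shift g = shift F * g"
  obtains k where "g = smult k F"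
proof -
  obtain N where N: "\<And>n. n \<ge> N \<Longrightarrow> poly F (of_nat n) \<noteq> 0"
    using poly_nonzero_eventually[OF \<open>F \<noteq> 0\<close>] by blast
  define k where "k = poly g (of_nat N) / poly F (of_nat N)"
  have "poly g (of_nat n) = k * poly F (of_nat n)" if "n \<ge> N" for n
    using that
  proof (induction n rule: dec_induct)
    case base
    then show ?case
      using N[of N] by (simp add: k_def)
  next
    case (step n)
    have "poly (F * shift g) (of_nat (Suc n)) = poly (shift F * g) (of_nat (Suc n))"
      using eq by simp
    then show ?case
      using step N[of n] by (simp add: mult.commute)
  qed
  then have "g - smult k F = 0"
    by (intro poly_zero_if_eventually_zero[of N]) auto
  then show ?thesis
    using that by simp
qed

text \<open>
  In lowest terms \<open>G / F\<close>, the equation sends a root \<open>z \<noteq> 0\<close> of \<open>F\<close> to the root \<open>z - 1\<close>, so all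
  roots are natural numbers, and a natural root \<open>z\<close> to the root \<open>z + 1\<close>. Hence \<open>F\<close> has no root.
\<close>

lemma denominator_constant:
  assumes "F \<noteq> 0" and cop: "coprime F G"
    and A: "\<And>n. poly A (of_nat (Suc n)) \<noteq> 0"
    and eq: "monom 1 (Suc S) * shift F * G = monom 1 S * A * F * shift G + K * F * shift F"
  shows "degree F = 0"
proof (rule ccontr)
  assume "degree F \<noteq> 0"
  have fin: "finite {x. poly F x = 0}"
    using \<open>F \<noteq> 0\<close> by (rule poly_roots_finite)
  have eq': "x ^ Suc S * poly F (x - 1) * poly G x =
      x ^ S * poly A x * poly F x * poly G (x - 1) + poly K x * poly F x * poly F (x - 1)" for x
    using arg_cong[OF eq, of "\<lambda>p. poly p x"] by (simp add: poly_monom)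
  have G: "poly G z \<noteq> 0" if "poly F z = 0" for z
  proof
    assume "poly G z = 0"
    with that have "is_unit [:-z, 1:]"
      using cop by (simp add: coprime_def poly_eq_0_iff_dvd)
    then show False
      by (simp add: is_unit_iff_degree)
  qed
  have down: "poly F (z - 1) = 0" if "poly F z = 0" "z \<noteq> 0" for z
    using eq'[of z] that G[OF that(1)] by simp
  \<comment> \<open>At \<open>x = n + 1\<close> two of the three terms contain
    \<open>F(n) = 0\<close>; in the third, \<open>A(n + 1)\<close> and \<open>G(n)\<close> are
    nonzero.\<close>
  have up: "poly F (of_nat (Suc n)) = 0" if "poly F (of_nat n) = 0" for n
  proof -
    have "of_nat (Suc n) - 1 = (of_nat n :: complex)" "of_nat (Suc n) \<noteq> (0 :: complex)"
      by (simp, rule of_nat_neq_0)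
    then show ?thesis
      using eq'[of "of_nat (Suc n)"] that A[of n] G[OF that] by (simp del: of_nat_Suc)
  qed
  obtain z where z: "poly F z = 0"
    using \<open>degree F \<noteq> 0\<close> fundamental_theorem_of_algebra[of F] constant_degree[of F] by auto
  have "\<exists>n. z = of_nat n"
  proof (rule ccontr)
    assume no: "\<nexists>n. z = of_nat n"
    have "poly F (z - of_nat n) = 0" for n
    proof (induction n)
      case (Suc n)
      have "z - of_nat n \<noteq> 0"
        using no by auto
      with down[OF Suc] show ?case
        by (simp add: algebra_simps)
    qed (use z in simp)
    then have "range (\<lambda>n. z - of_nat n) \<subseteq> {x. poly F x = 0}"
      by auto
    then have "finite (range (\<lambda>n::nat. z - of_nat n))"
      using fin finite_subset by blast
    then show False
      by (simp add: finite_image_iff inj_on_def)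
  qed
  then obtain m where m: "z = of_nat m" by blast
  have "poly F (of_nat n) = 0" if "n \<ge> m" for n
    using that by (induction n rule: dec_induct) (use z m up in auto)
  then have "F = 0"
    using poly_zero_if_eventually_zero by blast
  with \<open>F \<noteq> 0\<close> show False by simp
qed

text \<open>With \<open>h = G / F\<close> the equation reads
  \<open>h(x) = (A(x) / x) * h(x - 1) + K(x) / x ^ (S + 1)\<close>; the degree bound makes the last
  term a polynomial in \<open>1 / x\<close> without constant term.\<close>

lemma rational_difference_equation:
  assumes "F \<noteq> 0"
    and A: "A = [:0, 1:] \<or> A = [:-2, 4:]"
    and K: "degree K \<le> S"
    and eq: "monom 1 (Suc S) * shift F * G = monom 1 S * A * F * shift G + K * F * shift F"
  shows "K = 0"
proof -
  define D where "D = gcd F G"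
  obtain F' G' where FG: "F = F' * D" "G = G' * D" "coprime F' G'"
    using gcd_coprime_exists[of F G] \<open>F \<noteq> 0\<close> unfolding D_def by auto
  have "D \<noteq> 0" "F' \<noteq> 0"
    using FG \<open>F \<noteq> 0\<close> by auto
  \<comment> \<open>Every term contains the factor \<open>D * shift D\<close>, so the fraction may
    be reduced to lowest terms.\<close>
  have "(D * shift D) * (monom 1 (Suc S) * shift F' * G') =
        (D * shift D) * (monom 1 S * A * F' * shift G' + K * F' * shift F')"
    using eq by (simp add: FG algebra_simps)
  then have eq': "monom 1 (Suc S) * shift F' * G' = monom 1 S * A * F' * shift G' + K * F' * shift F'"
    using \<open>D \<noteq> 0\<close> by simp
  have "poly A (of_nat (Suc n)) \<noteq> 0" for n
  proof -
    have "2 + 4 * of_nat n \<noteq> (0::complex)"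
      using of_nat_neq_0[where 'a = complex, of "1 + 4 * n"] by simp
    moreover have "1 + of_nat n \<noteq> (0::complex)"
      by (metis of_nat_Suc of_nat_neq_0)
    ultimately show ?thesis
      using A by (auto simp: algebra_simps)
  qed
  then have "degree F' = 0"
    using denominator_constant[OF \<open>F' \<noteq> 0\<close> FG(3) _ eq'] by blast
  then obtain c where c: "F' = [:c:]"
    by (metis degree_eq_zeroE)
  have "c \<noteq> 0"
    using c \<open>F' \<noteq> 0\<close> by auto
  have "smult c (monom 1 (Suc S) * G') = smult c (monom 1 S * A * shift G' + smult c K)"
    using eq' unfolding c by (simp add: shift_def algebra_simps smult_add_right)
  then have eq2: "monom 1 (Suc S) * G' = monom 1 S * (A * shift G') + smult c K"
    using \<open>c \<noteq> 0\<close> by (simp only: smult_cancel mult.assoc)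
  \<comment> \<open>\<open>K\<close> has degree at most \<open>S\<close>, so it cannot reach the
    coefficients compared here.\<close>
  have top': "coeff (A * shift G') i = coeff (pCons 0 G') i" if "i > 0" for i
  proof -
    have "coeff K (S + i) = 0"
      using K that by (intro coeff_eq_0) auto
    then show ?thesis
      using arg_cong[OF eq2, of "\<lambda>p. coeff p (S + i)"] that
      by (cases i) (auto simp: coeff_monom_mult)
  qed
  show "K = 0"
    using A
  proof
    assume A: "A = [:0, 1:]"
    \<comment> \<open>In this case every coefficient is compared, so the two \<open>G'\<close> terms
      cancel exactly and only \<open>K\<close> is left.\<close>
    have "coeff (shift G') i = coeff G' i" for i
      using top'[of "Suc i"] by (simp add: A)
    then have "shift G' = G'"
      by (simp add: poly_eq_iff)
    then have "smult c K = 0"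
      using eq2 by (simp add: A monom_Suc)
    then show ?thesis
      using \<open>c \<noteq> 0\<close> by simp
  next
    assume A: "A = [:-2, 4:]"
    \<comment> \<open>\<open>A\<close> has leading coefficient 4 and shifting keeps that of
      \<open>G'\<close>, so a nonzero \<open>G'\<close> would force \<open>4 = 1\<close>.\<close>
    have "lead_coeff G' = 4 * lead_coeff G'"
      using top'[of "Suc (degree G')"] by (simp add: A coeff_eq_0)
    then have "G' = 0" by simp
    then have "smult c K = 0"
      using eq2 by (simp add: shift_def)
    then show ?thesis
      using \<open>c \<noteq> 0\<close> by simp
  qed
qed

subsection \<open>Linear independence\<close>

text \<open>
  The sequences satisfy \<open>n * u b (n - 1) = head_coeff b * u b n\<close> up to a multiple of \<open>u (tl b) n\<close>.
\<close>

definition head_coeff :: "nat list \<Rightarrow> complex poly" where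
  "head_coeff b = (if b = [] then [:-2, 4:] else [:0, 1:])"

text \<open>The relation is assumed only for \<open>n \<ge> N\<close> because the elimination looks
  back to \<open>n - 1\<close> and so raises the threshold at each round; closure under
  \<open>tl\<close> keeps the recursions inside \<open>B\<close>.\<close>

lemma linearly_independent:
  fixes u :: "nat list \<Rightarrow> nat \<Rightarrow> complex"
  assumes nonzero: "\<And>n. u [] n \<noteq> 0"
    and nil: "\<And>n. of_nat (Suc n) * u [] n = (4 * of_nat (Suc n) - 2) * u [] (Suc n)"
    and cons: "\<And>s b n. u (s # b) n = u (s # b) (Suc n) + u b (Suc n) / of_nat (Suc n) ^ s"
    and "finite B" "B \<subseteq> compositions" "\<And>b. b \<in> B \<Longrightarrow> tl b \<in> B"
    and "\<And>n. n \<ge> N \<Longrightarrow> (\<Sum>b\<in>B. poly (f b) (of_nat n) * u b n) = 0"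
  shows "\<forall>b\<in>B. f b = 0"
  using assms(4-)
proof (induction "card B" arbitrary: B f N rule: less_induct)
  case less
  note fin = less.prems(1) and comp = less.prems(2) and tl = less.prems(3) and rel = less.prems(4)
  show ?case
  proof (cases "B = {}")
    case False
    obtain b0 where b0: "b0 \<in> B" and max: "\<And>b. b \<in> B \<Longrightarrow> length b \<le> length b0"
    proof -
      have "Max (length ` B) \<in> length ` B"
        using fin False by (intro Max_in) auto
      then obtain b where "b \<in> B" "length b = Max (length ` B)" by auto
      then show ?thesis
        using fin by (intro that[of b]) auto
    qed
    show ?thesis
    proof (cases "b0 = []")
      case True
      then have B: "B = {[]}"
        using b0 max by fastforce
      have "f [] = 0"
        by (rule poly_zero_if_eventually_zero[of N]) (use rel nonzero in \<open>simp add: B\<close>)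
      then show ?thesis
        by (simp add: B)
    next
      case False
      define B' where "B' = B - {b0}"
      have B': "finite B'" "B' \<subseteq> compositions" "card B' < card B"
        using fin comp b0 unfolding B'_def by (blast, blast, intro card_Diff1_less)
      \<comment> \<open>Tails are strictly shorter than the nonempty longest list \<open>b0\<close>,
        so removing it preserves closure.\<close>
      have tl': "tl b \<in> B'" if "b \<in> B'" for b
      proof -
        have "length (tl b) < length b0"
          using max[of b] that False by (cases b) (auto simp: B'_def)
        then show ?thesis
          using tl that by (auto simp: B'_def)
      qed
      have "f b0 = 0"
      proof (rule ccontr)
        assume F0: "f b0 \<noteq> 0"
        define F where "F = f b0"
        \<comment> \<open>\<open>S\<close> bounds all entries, so multiplying by
          \<open>X ^ Suc S\<close> clears every denominator \<open>X ^ hd b\<close>.\<close>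
        define S where "S = Max (insert 0 (\<Union>b\<in>B. set b))"
        have S: "hd b \<le> Suc S" "hd b \<ge> 1" if "b \<in> B" "b \<noteq> []" for b
        proof -
          have "hd b \<in> (\<Union>b\<in>B. set b)"
            using that hd_in_set by blast
          then have "hd b \<le> S"
            unfolding S_def using fin by (intro Max_ge) auto
          then show "hd b \<le> Suc S" by simp
          show "hd b \<ge> 1"
            using comp that hd_in_set[of b] by (auto simp: compositions_def Suc_le_eq)
        qed
        \<comment> \<open>The lists whose recursion contributes a multiple of \<open>u b\<close>;
          \<open>[]\<close> must be left out because \<open>tl [] = []\<close>.\<close>
        define C where "C = (\<lambda>b. {x \<in> B - {[]}. tl x = b})"
        \<comment> \<open>\<open>Q b\<close> is the coefficient of \<open>u b n\<close> in
          \<open>X ^ Suc S\<close> times the combination of the relations at \<open>n - 1\<close>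
          and \<open>n\<close> with weights \<open>F(n)\<close> and \<open>-F(n - 1)\<close>, once
          the recursions are inserted.\<close>
        define Q where "Q = (\<lambda>b. F * (monom 1 S * head_coeff b * shift (f b) +
            (\<Sum>x\<in>C b. monom 1 (Suc S - hd x) * shift (f x))) - monom 1 (Suc S) * shift F * f b)"
        have leaf: "C x = {}" if "length x = length b0" for x
        proof -
          have False if "y \<in> C x" for y
            using that max[of y] \<open>length x = length b0\<close> by (cases y) (auto simp: C_def)
          then show ?thesis by blast
        qed
        \<comment> \<open>A longest list has no extension in \<open>B\<close> and its head
          coefficient is \<open>X\<close>, so its two contributions cancel; this is the drop in the
          number of terms.\<close>
        have Q0: "Q b0 = 0"
          using False by (simp add: Q_def leaf F_def head_coeff_def monom_Suc)
        have relQ: "(\<Sum>b\<in>B'. poly (Q b) (of_nat n) * u b n) = 0" if n: "n \<ge> Suc N" for n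
        proof -
          obtain m where m: "n = Suc m" "m \<ge> N"
            using n by (cases n) auto
          define X :: complex where "X = of_nat n"
          have X: "X \<noteq> 0" "X - 1 = of_nat m"
            unfolding X_def m(1) by (rule of_nat_neq_0, simp)
          have step: "X ^ Suc S * u b m = X ^ S * poly (head_coeff b) X * u b n +
              (if b = [] then 0 else X ^ (Suc S - hd b) * u (tl b) n)" if "b \<in> B" for b
          proof (cases b)
            case Nil
            have "X * u [] m = (4 * X - 2) * u [] n"
              using nil[of m] unfolding X_def m(1) .
            then show ?thesis
              by (simp add: Nil head_coeff_def)
          next
            case (Cons s c)
            have "s \<le> Suc S"
              using S(1)[OF that] Cons by simp
            then have "X ^ Suc S = X ^ (Suc S - s) * X ^ s"
              by (simp flip: power_add)
            moreover have "u b m = u b n + u c n / X ^ s"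
              using cons[of s c m] unfolding X_def m(1) Cons .
            ultimately have "X ^ Suc S * u b m = X ^ Suc S * u b n + X ^ (Suc S - s) * u c n"
              using X by (simp add: distrib_left)
            then show ?thesis
              by (simp add: Cons head_coeff_def mult.commute mult.left_commute)
          qed
          have "0 = X ^ Suc S * (\<Sum>b\<in>B. poly (f b) (X - 1) * u b m)"
            using rel[OF m(2)] X by simp
          also have "\<dots> = (\<Sum>b\<in>B. poly (f b) (X - 1) * (X ^ Suc S * u b m))"
            by (simp add: sum_distrib_left mult_ac)
          also have "\<dots> = (\<Sum>b\<in>B. poly (f b) (X - 1) * X ^ S * poly (head_coeff b) X * u b n) +
              (\<Sum>b\<in>B. if b = [] then 0 else poly (f b) (X - 1) * X ^ (Suc S - hd b) * u (tl b) n)"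
            unfolding sum.distrib[symmetric] by (intro sum.cong refl) (subst step, auto simp: algebra_simps)
          also have "(\<Sum>b\<in>B. if b = [] then 0 else poly (f b) (X - 1) * X ^ (Suc S - hd b) * u (tl b) n) =
              (\<Sum>b\<in>B - {[]}. poly (f b) (X - 1) * X ^ (Suc S - hd b) * u (tl b) n)"
            using fin by (intro sum.mono_neutral_cong_right) auto
          also have "\<dots> = (\<Sum>b\<in>B. \<Sum>x\<in>C b. poly (f x) (X - 1) * X ^ (Suc S - hd x) * u (tl x) n)"
            unfolding C_def using fin tl by (intro sum.group[symmetric]) auto
          also have "\<dots> = (\<Sum>b\<in>B. (\<Sum>x\<in>C b. poly (f x) (X - 1) * X ^ (Suc S - hd x)) * u b n)"
            unfolding sum_distrib_right by (intro sum.cong refl) (auto simp: C_def)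
          finally have prev: "(\<Sum>b\<in>B. poly (f b) (X - 1) * X ^ S * poly (head_coeff b) X * u b n) +
              (\<Sum>b\<in>B. (\<Sum>x\<in>C b. poly (f x) (X - 1) * X ^ (Suc S - hd x)) * u b n) = 0"
            by simp
          have cur: "(\<Sum>b\<in>B. poly (f b) X * u b n) = 0"
            using rel[of n] n by (simp add: X_def)
          have "(\<Sum>b\<in>B'. poly (Q b) X * u b n) = (\<Sum>b\<in>B. poly (Q b) X * u b n)"
            using fin Q0 b0 by (simp add: B'_def sum_diff1)
          also have "\<dots> = poly F X *
              ((\<Sum>b\<in>B. poly (f b) (X - 1) * X ^ S * poly (head_coeff b) X * u b n) +
               (\<Sum>b\<in>B. (\<Sum>x\<in>C b. poly (f x) (X - 1) * X ^ (Suc S - hd x)) * u b n)) -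
              X ^ Suc S * poly F (X - 1) * (\<Sum>b\<in>B. poly (f b) X * u b n)"
            unfolding sum_distrib_left sum.distrib[symmetric] sum_subtractf[symmetric]
            by (intro sum.cong refl)
              (simp add: Q_def poly_monom poly_sum algebra_simps sum_distrib_left sum_distrib_right)
          also have "\<dots> = 0"
            unfolding prev cur by simp
          finally show ?thesis
            by (simp add: X_def)
        qed
        have Q': "Q b = 0" if "b \<in> B" for b
          using less.hyps[OF B'(3,1,2) tl' relQ] Q0 that by (auto simp: B'_def)
        \<comment> \<open>Lists sharing the tail of \<open>b0\<close> also have maximal length,
          hence no extension; \<open>Q x = 0\<close> then says that \<open>f x / F\<close> has
          period 1.\<close>
        have const: "\<exists>k. f x = smult k F" if "x \<in> C (tl b0)" for x
        proof -
          have x: "x \<in> B" "x \<noteq> []" "tl x = tl b0"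
            using that by (auto simp: C_def)
          then have "length x = length b0"
            using False by (cases x; cases b0) auto
          then have "monom 1 (Suc S) * (F * shift (f x)) = monom 1 (Suc S) * (shift F * f x)"
            using Q'[OF x(1)] x(2) by (simp add: Q_def leaf head_coeff_def monom_Suc mult_ac)
          then have "F * shift (f x) = shift F * f x"
            by simp
          with F0 show ?thesis
            unfolding F_def by (rule proportional_if_shift_proportional) blast
        qed
        then obtain k where k: "\<And>x. x \<in> C (tl b0) \<Longrightarrow> f x = smult (k x) F"
          by metis
        \<comment> \<open>\<open>K / X ^ Suc S\<close> is the sum of the
          \<open>k x / X ^ hd x\<close>, the inhomogeneous part of the difference equation.\<close>
        define K where "K = (\<Sum>x\<in>C (tl b0). monom (k x) (Suc S - hd x))"
        have finC: "finite (C (tl b0))"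
          using fin by (simp add: C_def)
        have b0C: "b0 \<in> C (tl b0)"
          using b0 False by (simp add: C_def)
        have "(\<Sum>x\<in>C (tl b0). monom 1 (Suc S - hd x) * shift (f x)) = K * shift F"
          unfolding K_def sum_distrib_right
          by (intro sum.cong refl) (simp add: k smult_monom flip: mult_smult_left)
        \<comment> \<open>\<open>Q (tl b0) = 0\<close> is the difference equation for
          \<open>f (tl b0) / F\<close>.\<close>
        then have "monom 1 (Suc S) * shift F * f (tl b0) =
            monom 1 S * head_coeff (tl b0) * F * shift (f (tl b0)) + K * F * shift F"
          using Q'[OF tl[OF b0]] by (simp add: Q_def algebra_simps)
        moreover have "degree K \<le> S"
          unfolding K_def
        proof (rule degree_sum_le[OF finC])
          fix x assume "x \<in> C (tl b0)"
          then have "hd x \<ge> 1"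
            using S by (auto simp: C_def)
          then have "Suc S - hd x \<le> S" by simp
          then show "degree (monom (k x) (Suc S - hd x)) \<le> S"
            using degree_monom_le le_trans by blast
        qed
        ultimately have "K = 0"
          using F0 rational_difference_equation[of F "head_coeff (tl b0)"]
          unfolding F_def by (metis head_coeff_def)
        \<comment> \<open>Lists with the same tail differ in their heads, so the exponent belonging
          to \<open>b0\<close> occurs once and isolates \<open>k b0\<close>.\<close>
        have "coeff K (Suc S - hd b0) = (\<Sum>x\<in>C (tl b0). if x = b0 then k x else 0)"
          unfolding K_def coeff_sum
        proof (intro sum.cong refl)
          fix x assume "x \<in> C (tl b0)"
          then have x: "x \<in> B" "x \<noteq> []" "tl x = tl b0"
            by (auto simp: C_def)
          have "Suc S - hd x = Suc S - hd b0 \<longleftrightarrow> hd x = hd b0"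
            using S(1)[OF x(1,2)] S(1)[OF b0 False] by auto
          also have "\<dots> \<longleftrightarrow> x = b0"
            using x False by (metis list.expand)
          finally show "coeff (monom (k x) (Suc S - hd x)) (Suc S - hd b0) = (if x = b0 then k x else 0)"
            by simp
        qed
        also have "\<dots> = k b0"
          using b0C finC by simp
        finally have "k b0 = 0"
          using \<open>K = 0\<close> by simp
        then show False
          using k[OF b0C] F0 by simp
      qed
      have "(\<Sum>b\<in>B'. poly (f b) (of_nat n) * u b n) = 0" if "n \<ge> N" for n
        using rel[OF that] \<open>f b0 = 0\<close> fin b0 by (simp add: B'_def sum_diff1)
      then have "\<forall>b\<in>B'. f b = 0"
        using less.hyps[OF B'(3,1,2) tl'] by blast
      then show ?thesis
        using \<open>f b0 = 0\<close> by (auto simp: B'_def)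
    qed
  qed simp
qed

subsection \<open>Exponentially decaying sequences and their tail sums\<close>

text \<open>Geometric decay survives integer powers, polynomial factors and \<open>tail\<close>, so
  every series that occurs converges.\<close>

definition exp_decay :: "(nat \<Rightarrow> real) \<Rightarrow> bool" where
  "exp_decay w \<longleftrightarrow> (\<exists>C r. 0 < r \<and> r < 1 \<and> (\<forall>n. \<bar>w n\<bar> \<le> C * r ^ n))"

definition tail :: "(nat \<Rightarrow> real) \<Rightarrow> nat \<Rightarrow> real" where
  "tail w n = (\<Sum>j. w (Suc (n + j)))"

lemma exp_decayE:
  assumes "exp_decay w"
  obtains C r where "0 \<le> C" "0 < r" "r < 1" "\<And>n. \<bar>w n\<bar> \<le> C * r ^ n"
proof -
  obtain C r where *: "0 < r" "r < 1" "\<And>n. \<bar>w n\<bar> \<le> C * r ^ n"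
    using assms by (auto simp: exp_decay_def)
  moreover have "0 \<le> C"
    using *(3)[of 0] by simp
  ultimately show ?thesis using that by blast
qed

lemma exp_decay_mono:
  assumes "exp_decay w" "\<And>n. \<bar>v n\<bar> \<le> \<bar>w n\<bar>"
  shows "exp_decay v"
  using assms unfolding exp_decay_def by (meson order_trans)

lemma exp_decay_add:
  assumes "exp_decay v" "exp_decay w"
  shows "exp_decay (\<lambda>n. v n + w n)"
proof -
  obtain C r where v: "0 \<le> C" "0 < r" "r < 1" "\<And>n. \<bar>v n\<bar> \<le> C * r ^ n"
    using assms(1) by (rule exp_decayE) blast
  obtain D q where w: "0 \<le> D" "0 < q" "q < 1" "\<And>n. \<bar>w n\<bar> \<le> D * q ^ n"
    using assms(2) by (rule exp_decayE) blast
  have "\<bar>v n + w n\<bar> \<le> (C + D) * max r q ^ n" for n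
  proof -
    have "\<bar>v n + w n\<bar> \<le> C * r ^ n + D * q ^ n"
      using v(4)[of n] w(4)[of n] by linarith
    also have "\<dots> \<le> C * max r q ^ n + D * max r q ^ n"
      using v w by (intro add_mono mult_left_mono power_mono) auto
    finally show ?thesis by (simp add: algebra_simps)
  qed
  then show ?thesis
    unfolding exp_decay_def using v w by (intro exI[of _ "C + D"] exI[of _ "max r q"]) auto
qed

lemma exp_decay_cmult:
  assumes "exp_decay w"
  shows "exp_decay (\<lambda>n. c * w n)"
proof -
  obtain C r where w: "0 \<le> C" "0 < r" "r < 1" "\<And>n. \<bar>w n\<bar> \<le> C * r ^ n"
    using assms by (rule exp_decayE) blast
  have "\<bar>c * w n\<bar> \<le> (\<bar>c\<bar> * C) * r ^ n" for n
    using mult_left_mono[OF w(4)[of n], of "\<bar>c\<bar>"] by (simp add: abs_mult mult.assoc)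
  then show ?thesis
    unfolding exp_decay_def using w by blast
qed

lemma exp_decay_mult_of_nat:
  assumes "exp_decay w"
  shows "exp_decay (\<lambda>n. real n * w n)"
proof -
  obtain C r where w: "0 \<le> C" "0 < r" "r < 1" "\<And>n. \<bar>w n\<bar> \<le> C * r ^ n"
    using assms by (rule exp_decayE) blast
  \<comment> \<open>Any ratio strictly between \<open>r\<close> and 1 absorbs the factor
    \<open>n\<close>, because \<open>n * (r / q) ^ n\<close> is bounded.\<close>
  define q where "q = (1 + r) / 2"
  have q: "0 < q" "q < 1" "r < q"
    using w by (auto simp: q_def)
  have "(\<lambda>n. real n * (r / q) ^ n) \<longlonglongrightarrow> 0"
    using powser_times_n_limit_0[of "r / q"] w q by simp
  then have "Bseq (\<lambda>n. real n * (r / q) ^ n)"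
    using convergentI convergent_imp_Bseq by blast
  then obtain D where D: "\<And>n. norm (real n * (r / q) ^ n) \<le> D"
    unfolding Bseq_def by blast
  have "\<bar>real n * w n\<bar> \<le> (C * D) * q ^ n" for n
  proof -
    have "\<bar>real n * w n\<bar> \<le> real n * (C * r ^ n)"
      using w(4)[of n] by (simp add: abs_mult mult_left_mono)
    also have "\<dots> = C * (real n * (r / q) ^ n) * q ^ n"
      using q by (simp add: power_divide)
    also have "\<dots> \<le> C * D * q ^ n"
      using D[of n] w q by (intro mult_right_mono mult_left_mono) auto
    finally show ?thesis .
  qed
  then show ?thesis
    unfolding exp_decay_def using q by blast
qed

lemma exp_decay_mult_power:
  assumes "exp_decay w"
  shows "exp_decay (\<lambda>n. (real n + 1) ^ k * w n)"
proof (induction k)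
  case (Suc k)
  have "exp_decay (\<lambda>n. real n * ((real n + 1) ^ k * w n) + (real n + 1) ^ k * w n)"
    by (intro exp_decay_add exp_decay_mult_of_nat Suc)
  then show ?case
    by (simp add: algebra_simps)
qed (use assms in simp)

lemma abs_powi_le: "\<bar>real n powi k\<bar> \<le> (real n + 1) ^ nat \<bar>k\<bar>"
proof (cases "k \<ge> 0")
  case True
  then show ?thesis
    by (auto simp: power_int_def power_mono)
next
  case False
  show ?thesis
  proof (cases "n = 0")
    case False
    have "inverse (real n) ^ nat (- k) \<le> 1"
      using False by (intro power_le_one) (auto simp: field_simps)
    moreover have "1 \<le> (real n + 1) ^ nat \<bar>k\<bar>"
      by (intro one_le_power) simp
    moreover have "\<bar>real n powi k\<bar> = inverse (real n) ^ nat (- k)"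
      using \<open>\<not> k \<ge> 0\<close> by (simp add: power_int_def)
    ultimately show ?thesis
      by linarith
  qed (use False in \<open>simp add: power_int_def power_0_left\<close>)
qed

lemma exp_decay_mult_powi:
  assumes "exp_decay w"
  shows "exp_decay (\<lambda>n. real n powi k * w n)"
proof (rule exp_decay_mono[OF exp_decay_mult_power[OF assms, of "nat \<bar>k\<bar>"]])
  show "\<bar>real n powi k * w n\<bar> \<le> \<bar>(real n + 1) ^ nat \<bar>k\<bar> * w n\<bar>" for n
    using mult_right_mono[OF abs_powi_le[of n k], of "\<bar>w n\<bar>"] by (simp add: abs_mult)
qed

lemma geometric_tail_sums:
  fixes C r :: real
  assumes "0 < r" "r < 1"
  shows "(\<lambda>j. C * r ^ Suc (n + j)) sums (C * r / (1 - r) * r ^ n)"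
proof -
  have "(\<lambda>j. C * r ^ Suc n * r ^ j) sums (C * r ^ Suc n * (1 / (1 - r)))"
    using assms by (intro sums_mult geometric_sums) auto
  then show ?thesis
    by (simp add: power_add mult_ac)
qed

lemma exp_decay_tail_sums:
  assumes "exp_decay w"
  shows "(\<lambda>j. w (Suc (n + j))) sums tail w n"
proof -
  obtain C r where w: "0 \<le> C" "0 < r" "r < 1" "\<And>n. \<bar>w n\<bar> \<le> C * r ^ n"
    using assms by (rule exp_decayE) blast
  have "summable (\<lambda>j. w (Suc (n + j)))"
  proof (rule summable_comparison_test'[where N = 0])
    show "summable (\<lambda>j. C * r ^ Suc (n + j))"
      using geometric_tail_sums[OF w(2,3)] by (rule sums_summable)
    show "norm (w (Suc (n + j))) \<le> C * r ^ Suc (n + j)" for j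
      unfolding real_norm_def by (rule w(4))
  qed
  then show ?thesis
    unfolding tail_def by (rule summable_sums)
qed

lemma exp_decay_tail:
  assumes "exp_decay w"
  shows "exp_decay (tail w)"
proof -
  obtain C r where w: "0 \<le> C" "0 < r" "r < 1" "\<And>n. \<bar>w n\<bar> \<le> C * r ^ n"
    using assms by (rule exp_decayE) blast
  have "\<bar>tail w n\<bar> \<le> (C * r / (1 - r)) * r ^ n" for n
  proof -
    have 1: "w (Suc (n + j)) \<le> C * r ^ Suc (n + j)" for j
      using w(4)[of "Suc (n + j)"] by linarith
    have 2: "- w (Suc (n + j)) \<le> C * r ^ Suc (n + j)" for j
      using w(4)[of "Suc (n + j)"] by linarith
    show ?thesis
      using sums_le[OF 1 exp_decay_tail_sums[OF assms] geometric_tail_sums[OF w(2,3)]]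
        sums_le[OF 2 sums_minus[OF exp_decay_tail_sums[OF assms]] geometric_tail_sums[OF w(2,3)]]
      by linarith
  qed
  then show ?thesis
    unfolding exp_decay_def using w by blast
qed

lemma exp_decay_tendsto_0:
  assumes "exp_decay w"
  shows "w \<longlonglongrightarrow> 0"
proof -
  have "(\<lambda>n. w (Suc (0 + n))) \<longlonglongrightarrow> 0"
    using exp_decay_tail_sums[OF assms, of 0] sums_summable summable_LIMSEQ_zero by blast
  then show ?thesis
    using filterlim_sequentially_Suc[of w] by simp
qed

lemma tail_Suc:
  assumes "exp_decay w"
  shows "tail w n = tail w (Suc n) + w (Suc n)"
proof -
  have "(\<lambda>j. w (Suc (n + Suc j))) sums (tail w n - w (Suc (n + 0)))"
    using exp_decay_tail_sums[OF assms, of n] by (subst sums_Suc_iff) simp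
  then show ?thesis
    using exp_decay_tail_sums[OF assms, of "Suc n"] sums_unique2 by fastforce
qed

lemma tail_add:
  assumes "exp_decay v" "exp_decay w"
  shows "tail (\<lambda>m. v m + w m) n = tail v n + tail w n"
  using sums_add[OF exp_decay_tail_sums[OF assms(1)] exp_decay_tail_sums[OF assms(2)]]
  by (simp add: tail_def sums_iff)

lemma tail_cmult:
  assumes "exp_decay w"
  shows "tail (\<lambda>m. c * w m) n = c * tail w n"
  using sums_mult[OF exp_decay_tail_sums[OF assms]] by (simp add: tail_def sums_iff)

lemma tail_cong:
  assumes "\<And>m. v (Suc m) = w (Suc m)"
  shows "tail v = tail w"
  using assms by (simp add: tail_def fun_eq_iff)

text \<open>The partial sums collapse to \<open>v n - v (n + k)\<close>, and decay sends the second
  term to 0.\<close>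

lemma tail_telescope:
  assumes "exp_decay v" "\<And>m. w (Suc m) = v m - v (Suc m)"
  shows "tail w n = v n"
proof -
  have "(\<lambda>j. v (n + j)) \<longlonglongrightarrow> 0"
    using LIMSEQ_ignore_initial_segment[OF exp_decay_tendsto_0[OF assms(1)], of n]
    by (simp add: add.commute)
  from telescope_sums'[OF this] show ?thesis
    by (simp add: tail_def assms(2) sums_iff)
qed

section \<open>The sums as iterated tails, and their recursions\<close>

fun cbs :: "int list \<Rightarrow> nat \<Rightarrow> real" where
  "cbs [] = (\<lambda>n. inverse (real ((2 * n) choose n)))"
| "cbs (s # t) = tail (\<lambda>m. real m powi (- s) * cbs t m)"

text \<open>Absorption is applied twice, with the symmetry of the binomial coefficients of
  \<open>2 * n + 1\<close> in between.\<close>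

lemma central_binomial_rec:
  "Suc n * ((2 * Suc n) choose Suc n) = (4 * n + 2) * ((2 * n) choose n)"
proof -
  have "Suc n * ((2 * Suc n) choose Suc n) = 2 * (Suc n * (Suc (2 * n) choose n))"
    using Suc_times_binomial_eq[of "Suc (2 * n)" n] by (simp add: algebra_simps)
  also have "Suc n * (Suc (2 * n) choose n) = Suc (2 * n) * ((2 * n) choose n)"
    using Suc_times_binomial_eq[of "2 * n" n] binomial_symmetric[of n "Suc (2 * n)"]
      by (simp add: mult.commute)
  finally show ?thesis
    by (simp add: algebra_simps)
qed

lemma cbs_Nil_rec: "real (Suc n) * cbs [] n = (4 * real (Suc n) - 2) * cbs [] (Suc n)"
proof -
  have "real (Suc n) * real ((2 * Suc n) choose Suc n) = (4 * real n + 2) * real ((2 * n) choose n)"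
    using arg_cong[OF central_binomial_rec[of n], of real] by (simp only: of_nat_mult of_nat_add of_nat_numeral)
  moreover have "0 < (2 * n) choose n" "0 < (2 * Suc n) choose Suc n"
    by (rule zero_less_binomial, simp)+
  ultimately show ?thesis
    by (simp add: field_simps del: binomial_Suc_Suc mult_Suc_right)
qed

lemma exp_decay_cbs: "exp_decay (cbs t)"
proof (induction t)
  case Nil
  have *: "\<bar>cbs [] n\<bar> \<le> 1 * (1 / 2) ^ n" for n
  proof (induction n)
    case (Suc n)
    \<comment> \<open>By the recursion the ratio of consecutive terms is
      \<open>(n + 1) / (4 * n + 2)\<close>, which is at most \<open>1 / 2\<close>.\<close>
    have "cbs [] (Suc n) \<le> 1 / 2 * cbs [] n"
    proof -
      have "cbs [] (Suc n) \<ge> 0" by simp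
      then have "real n * cbs [] (Suc n) \<ge> 0" by (intro mult_nonneg_nonneg) auto
      then have "real (Suc n) * (2 * cbs [] (Suc n)) \<le> (4 * real (Suc n) - 2) * cbs [] (Suc n)"
        by (simp add: algebra_simps del: cbs.simps)
      also have "\<dots> = real (Suc n) * cbs [] n"
        by (rule cbs_Nil_rec[symmetric])
      finally show ?thesis
        by (simp del: cbs.simps of_nat_Suc)
    qed
    moreover have "cbs [] (Suc n) \<ge> 0" by simp
    ultimately show ?case
      using Suc by (simp del: cbs.simps)
  qed simp
  have "0 < (1/2::real) \<and> (1/2::real) < 1 \<and> (\<forall>n. \<bar>cbs [] n\<bar> \<le> 1 * (1 / 2) ^ n)"
    using * by auto
  then show ?case
    unfolding exp_decay_def by blast
next
  case (Cons s t)
  then show ?case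
    by (simp add: exp_decay_tail exp_decay_mult_powi)
qed

lemma cbs_Cons_Suc:
  "cbs (s # t) n = cbs (s # t) (Suc n) + real (Suc n) powi (- s) * cbs t (Suc n)"
proof -
  have "exp_decay (\<lambda>m. real m powi (- s) * cbs t m)"
    by (intro exp_decay_mult_powi exp_decay_cbs)
  from tail_Suc[OF this, of n] show ?thesis
    unfolding cbs.simps(2) .
qed

section \<open>Identification with the sums over decreasing index lists\<close>

lemma cbs_nonneg: "cbs t n \<ge> 0"
proof (induction t arbitrary: n)
  case (Cons s t)
  define w where "w = (\<lambda>m. real m powi (- s) * cbs t m)"
  have "exp_decay w"
    unfolding w_def by (intro exp_decay_mult_powi exp_decay_cbs)
  moreover have "0 \<le> w m" for m
    unfolding w_def by (intro mult_nonneg_nonneg zero_le_power_int Cons) simp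
  ultimately have "0 \<le> tail w n"
    by (intro sums_le[OF _ sums_zero exp_decay_tail_sums])
  then show ?case
    by (simp add: w_def)
qed simp

text \<open>Appending \<open>n\<close> before taking the head makes the formula correct for the empty list as well.\<close>

definition cb_term :: "int list \<Rightarrow> nat \<Rightarrow> nat list \<Rightarrow> real" where
  "cb_term s n ns = inverse (real ((2 * hd (ns @ [n])) choose (hd (ns @ [n])))) *
     (\<Prod>i<length s. real (ns ! i) powi (- (s ! i)))"

text \<open>Nonnegativity turns the ordered series into an unconditional sum.\<close>

lemma has_sum_tail:
  assumes "exp_decay w" "\<And>m. w m \<ge> 0"
  shows "(w has_sum tail w n) {n<..}"
proof -
  have "((\<lambda>j. w (Suc (n + j))) has_sum tail w n) UNIV"
    using exp_decay_tail_sums[OF assms(1)] assms(2) by (rule sums_nonneg_imp_has_sum)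
  also have "?this \<longleftrightarrow> ?thesis"
    by (rule has_sum_reindex_bij_witness[of _ "\<lambda>m. m - Suc n" "\<lambda>j. Suc (n + j)"]) auto
  finally show ?thesis .
qed

lemma decr_above_snoc: "xs @ [m] \<in> decr_above (Suc r) n \<longleftrightarrow> n < m \<and> xs \<in> decr_above r m"
  by (auto simp: decr_above_def sorted_wrt_append)

text \<open>The last entry of an index list is its smallest, some \<open>m > n\<close>, and what
  precedes it is an index list above \<open>m\<close>. As all terms are nonnegative, the iterated
  sum merges into one sum over pairs.\<close>

lemma has_sum_cb_term: "(cb_term s n has_sum cbs (rev s) n) (decr_above (length s) n)"
proof (induction s arbitrary: n rule: rev_induct)
  case Nil
  have "decr_above 0 n = {[]}"
    by (auto simp: decr_above_def)
  moreover have "cb_term [] n [] = cbs [] n"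
    by (simp add: cb_term_def)
  ultimately show ?case
    using has_sum_finite[of "{[]}" "cb_term [] n"] by simp
next
  case (snoc a s)
  define w where "w = (\<lambda>m. real m powi (- a) * cbs (rev s) m)"
  have w: "exp_decay w" "\<And>m. w m \<ge> 0"
    unfolding w_def by (auto intro!: exp_decay_mult_powi exp_decay_cbs mult_nonneg_nonneg cbs_nonneg zero_le_power_int)
  define g where "g = (\<lambda>(m, xs). real m powi (- a) * cb_term s m xs)"
  have inner: "((\<lambda>xs. g (m, xs)) has_sum w m) (decr_above (length s) m)" for m
    unfolding g_def w_def using has_sum_cmult_right[OF snoc] by simp
  have outer: "(w has_sum tail w n) {n<..}"
    using w by (rule has_sum_tail)
  have "g summable_on (SIGMA m:{n<..}. decr_above (length s) m)"
  proof (rule summable_on_SigmaI[OF inner])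
    show "w summable_on {n<..}"
      using outer summable_on_def by blast
    show "g (m, xs) \<ge> 0" for m xs
      by (auto simp: g_def cb_term_def intro!: mult_nonneg_nonneg prod_nonneg zero_le_power_int)
  qed
  then have "(g has_sum tail w n) (SIGMA m:{n<..}. decr_above (length s) m)"
    by (rule has_sum_SigmaI[OF inner outer])
  also have "?this \<longleftrightarrow> (cb_term (s @ [a]) n has_sum tail w n) (decr_above (length (s @ [a])) n)"
  proof (rule has_sum_reindex_bij_witness[of _ "\<lambda>ns. (last ns, butlast ns)" "\<lambda>(m, xs). xs @ [m]"])
    fix p assume p: "p \<in> (SIGMA m:{n<..}. decr_above (length s) m)"
    obtain m xs where mxs: "p = (m, xs)" by (cases p)
    have len: "length xs = length s"
      using p by (simp add: mxs decr_above_def)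
    show "(last (case p of (m, xs) \<Rightarrow> xs @ [m]), butlast (case p of (m, xs) \<Rightarrow> xs @ [m])) = p"
      by (simp add: mxs)
    show "(case p of (m, xs) \<Rightarrow> xs @ [m]) \<in> decr_above (length (s @ [a])) n"
      using p by (simp add: mxs decr_above_snoc)
    have "(\<Prod>i<length s. real ((xs @ [m]) ! i) powi - ((s @ [a]) ! i)) =
        (\<Prod>i<length s. real (xs ! i) powi - (s ! i))"
      using len by (intro prod.cong) (auto simp: nth_append)
    \<comment> \<open>For empty \<open>xs\<close> both sides evaluate the binomial coefficient at
      \<open>m\<close>, which is the default head in \<open>cb_term s m xs\<close>.\<close>
    moreover have "hd ((xs @ [m]) @ [n]) = hd (xs @ [m])"
      by (cases xs) auto
    ultimately show "cb_term (s @ [a]) n (case p of (m, xs) \<Rightarrow> xs @ [m]) = g p"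
      using len by (simp add: mxs cb_term_def g_def nth_append)
  next
    fix ns assume ns: "ns \<in> decr_above (length (s @ [a])) n"
    then have "ns \<noteq> []" by (auto simp: decr_above_def)
    then have eq: "butlast ns @ [last ns] = ns" by simp
    then show "(case (last ns, butlast ns) of (m, xs) \<Rightarrow> xs @ [m]) = ns" by simp
    show "(last ns, butlast ns) \<in> (SIGMA m:{n<..}. decr_above (length s) m)"
      using ns decr_above_snoc[of "butlast ns" "last ns" "length s" n] by (simp add: eq)
  qed simp
  finally show ?case
    by (simp add: w_def)
qed

text \<open>All bases are positive integers, so the complex powers with integer exponents are real
  and the whole sum is the image of a real one.\<close>

lemma cb_sigma_eq_cbs: "cb_sigma (map of_int s) n = of_real (cbs (rev s) n)"
proof (cases "s = []")
  case False
  have summand: "inverse (of_nat ((2 * hd ns) choose (hd ns))) *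
      (\<Prod>i<length s. of_nat (ns ! i) powr (- of_int (s ! i))) = complex_of_real (cb_term s n ns)"
    if "ns \<in> decr_above (length s) n" for ns
  proof -
    have len: "length ns = length s" and pos: "\<And>x. x \<in> set ns \<Longrightarrow> x > n"
      using that by (auto simp: decr_above_def sorted_wrt_append)
    have "(of_nat (ns ! i) :: complex) powr (- of_int (s ! i)) = of_real (real (ns ! i) powi (- (s ! i)))"
      if "i < length s" for i
    proof -
      have "ns ! i > 0"
        using pos[of "ns ! i"] that len by simp
      then show ?thesis
        using complex_powr_of_int[of "of_nat (ns ! i)" "- (s ! i)"] that by simp
    qed
    moreover have "hd (ns @ [n]) = hd ns"
      using len False by (cases ns) auto
    ultimately show ?thesis
      by (simp add: cb_term_def)
  qed
  have "((\<lambda>ns. complex_of_real (cb_term s n ns)) has_sum of_real (cbs (rev s) n)) (decr_above (length s) n)"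
    by (intro has_sum_of_real has_sum_cb_term)
  then have "(\<Sum>\<^sub>\<infinity>ns\<in>decr_above (length s) n. complex_of_real (cb_term s n ns)) = of_real (cbs (rev s) n)"
    by (rule infsumI)
  moreover have "cb_sigma (map of_int s) n =
      (\<Sum>\<^sub>\<infinity>ns\<in>decr_above (length s) n. complex_of_real (cb_term s n ns))"
    unfolding cb_sigma_def using False by (simp, intro infsum_cong summand)
  ultimately show ?thesis
    by simp
qed (simp add: cb_sigma_def)

subsection \<open>The module spanned by the tails\<close>

definition pv :: "rat poly \<Rightarrow> nat \<Rightarrow> real" where
  "pv p n = of_rat (poly p (of_nat n))"

lemma pv_simps [simp]:
  "pv 0 n = 0" "pv 1 n = 1"
  "pv (pCons a p) n = of_rat a + real n * pv p n"
  "pv (p + q) n = pv p n + pv q n"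
  "pv (p - q) n = pv p n - pv q n"
  "pv (p * q) n = pv p n * pv q n"
  "pv (smult a p) n = of_rat a * pv p n"
  by (simp_all add: pv_def of_rat_add of_rat_diff of_rat_mult)

lemma pv_monom: "pv (monom 1 k) n = real n ^ k"
  by (simp add: pv_def poly_monom of_rat_power)

lemma exp_decay_pv_mult:
  assumes "exp_decay w"
  shows "exp_decay (\<lambda>n. pv p n * w n)"
proof (induction p)
  case 0
  show ?case
    using exp_decay_cmult[OF assms, of 0] by simp
next
  case (pCons a p)
  have "exp_decay (\<lambda>n. of_rat a * w n + real n * (pv p n * w n))"
    by (intro exp_decay_add exp_decay_cmult exp_decay_mult_of_nat pCons assms)
  then show ?case
    by (simp add: algebra_simps)
qed

text \<open>The \<open>\<rat>[n]\<close>-module generated by the compositions, built one summand at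
  a time so that closure properties follow by induction without tracking supports;
  \<open>poly_span_explicit\<close> recovers the coefficient family.\<close>

inductive_set poly_span :: "(nat \<Rightarrow> real) set" where
  zero: "(\<lambda>_. 0) \<in> poly_span"
| plus: "b \<in> compositions \<Longrightarrow> u \<in> poly_span \<Longrightarrow>
    (\<lambda>n. pv p n * cbs (map int b) n + u n) \<in> poly_span"

lemma poly_span_base:
  assumes "b \<in> compositions"
  shows "(\<lambda>n. pv p n * cbs (map int b) n) \<in> poly_span"
  using poly_span.plus[OF assms poly_span.zero, of p] by simp

lemma poly_span_add:
  assumes "u \<in> poly_span" "v \<in> poly_span"
  shows "(\<lambda>n. u n + v n) \<in> poly_span"
  using assms(1)
proof induction
  case (plus b u p)
  then show ?case
    using poly_span.plus[OF plus(1,3), of p] by (simp add: add.assoc)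
qed (use assms(2) in simp)

lemma poly_span_cmult:
  assumes "u \<in> poly_span"
  shows "(\<lambda>n. of_rat c * u n) \<in> poly_span"
  using assms
proof induction
  case zero
  show ?case using poly_span.zero by simp
next
  case (plus b u p)
  then show ?case
    using poly_span.plus[OF plus(1,3), of "smult c p"] by (simp add: algebra_simps)
qed

lemma poly_span_explicit:
  assumes "u \<in> poly_span"
  shows "\<exists>f. (\<forall>b. b \<notin> compositions \<longrightarrow> f b = 0) \<and> finite {b. f b \<noteq> 0} \<and>
    (\<forall>n. u n = (\<Sum>b | f b \<noteq> 0. pv (f b) n * cbs (map int b) n))"
  using assms
proof induction
  case zero
  show ?case by (rule exI[of _ "\<lambda>_. 0"]) simp
next
  case (plus b u p)
  then obtain f where f: "\<forall>b. b \<notin> compositions \<longrightarrow> f b = 0" "finite {b. f b \<noteq> 0}"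
    "\<And>n. u n = (\<Sum>b | f b \<noteq> 0. pv (f b) n * cbs (map int b) n)" by blast
  define g where "g = f(b := f b + p)"
  \<comment> \<open>Adding \<open>p\<close> may cancel the old coefficient of \<open>b\<close>, so
    both sums are extended by zeros to a common index set.\<close>
  define B where "B = insert b {b. f b \<noteq> 0}"
  have B: "finite B" "{b. g b \<noteq> 0} \<subseteq> B"
    using f(2) by (auto simp: B_def g_def split: if_splits)
  have "pv p n * cbs (map int b) n + u n = (\<Sum>b | g b \<noteq> 0. pv (g b) n * cbs (map int b) n)" for n
  proof -
    have "u n = (\<Sum>b\<in>B. pv (f b) n * cbs (map int b) n)"
      unfolding f(3) using B(1) by (intro sum.mono_neutral_left) (auto simp: B_def)
    moreover have "pv p n * cbs (map int b) n = (\<Sum>c\<in>B. if c = b then pv p n * cbs (map int c) n else 0)"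
      using B(1) by (simp add: B_def)
    ultimately have "pv p n * cbs (map int b) n + u n = (\<Sum>c\<in>B. pv (g c) n * cbs (map int c) n)"
      by (simp only: sum.distrib[symmetric]) (intro sum.cong, auto simp: g_def algebra_simps)
    also have "\<dots> = (\<Sum>b | g b \<noteq> 0. pv (g b) n * cbs (map int b) n)"
      using B by (intro sum.mono_neutral_right) auto
    finally show ?thesis .
  qed
  moreover have "\<forall>b. b \<notin> compositions \<longrightarrow> g b = 0"
    using f(1) plus(1) by (auto simp: g_def)
  ultimately show ?case
    using finite_subset[OF B(2,1)] by blast
qed

section \<open>Sequences whose tail sums stay in the module\<close>

definition tail_in_span :: "(nat \<Rightarrow> real) \<Rightarrow> bool" where
  "tail_in_span w \<longleftrightarrow> exp_decay w \<and> tail w \<in> poly_span"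

lemma tail_in_span_add: "tail_in_span v \<Longrightarrow> tail_in_span w \<Longrightarrow> tail_in_span (\<lambda>n. v n + w n)"
  unfolding tail_in_span_def using poly_span_add[of "tail v" "tail w"] tail_add[of v w]
  by (simp add: exp_decay_add ext[of "tail (\<lambda>n. v n + w n)" "\<lambda>n. tail v n + tail w n"])

lemma tail_in_span_cmult: "tail_in_span w \<Longrightarrow> tail_in_span (\<lambda>n. of_rat c * w n)"
  unfolding tail_in_span_def using poly_span_cmult[of "tail w" c] tail_cmult[of w "of_rat c"]
  by (simp add: exp_decay_cmult ext[of "tail (\<lambda>n. of_rat c * w n)" "\<lambda>n. of_rat c * tail w n"])

lemma tail_in_span_zero: "tail_in_span (\<lambda>_. 0)"
proof -
  have "exp_decay (\<lambda>_. 0)"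
    using exp_decay_cmult[OF exp_decay_cbs, of 0 "[]"] by simp
  moreover have "tail (\<lambda>_. 0) = (\<lambda>_. 0)"
    by (simp add: tail_def fun_eq_iff)
  ultimately show ?thesis
    using poly_span.zero by (simp add: tail_in_span_def)
qed

text \<open>Tail sums never reach index 0. This matters for integer powers, as
  \<open>x powi (k + 1) = x * x powi k\<close> fails at \<open>x = 0\<close> for
  \<open>k = -1\<close>.\<close>

lemma tail_in_span_cong:
  assumes "tail_in_span w" "exp_decay v" "\<And>m. v (Suc m) = w (Suc m)"
  shows "tail_in_span v"
  using assms tail_cong[of v w, OF assms(3)] by (simp add: tail_in_span_def)

text \<open>The form of summation by parts used below: \<open>v\<close> is the boundary term and
  \<open>w'\<close> the simpler remainder, so that \<open>tail w = v + tail w'\<close>.\<close>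

lemma tail_in_span_telescope:
  assumes "exp_decay w" "exp_decay v" "v \<in> poly_span" "tail_in_span w'"
    and "\<And>m. w (Suc m) = v m - v (Suc m) + w' (Suc m)"
  shows "tail_in_span w"
proof -
  have w': "exp_decay w'"
    using assms(4) by (simp add: tail_in_span_def)
  have "tail w n = v n + tail w' n" for n
  proof -
    have "exp_decay (\<lambda>m. w m + (-1) * w' m)"
      by (intro exp_decay_add exp_decay_cmult assms w')
    then have "tail w n = tail (\<lambda>m. w m + (-1) * w' m) n + tail w' n"
      using w' by (subst tail_add[symmetric]) auto
    also have "tail (\<lambda>m. w m + (-1) * w' m) n = v n"
      by (rule tail_telescope[OF assms(2)]) (simp add: assms(5))
    finally show ?thesis .
  qed
  then have "tail w = (\<lambda>n. v n + tail w' n)" by blast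
  then show ?thesis
    using assms poly_span_add[of v "tail w'"] by (simp add: tail_in_span_def)
qed

text \<open>Multiplying by the variable raises the exponent by one, hence the induction on
  \<open>p\<close> with \<open>k\<close> arbitrary.\<close>

lemma tail_in_span_pv_powi_mult:
  assumes "\<And>k. tail_in_span (\<lambda>m. real m powi k * u m)" "exp_decay u"
  shows "tail_in_span (\<lambda>m. pv p m * (real m powi k * u m))"
proof (induction p arbitrary: k)
  case 0
  show ?case using tail_in_span_zero by simp
next
  case (pCons a p)
  have "tail_in_span (\<lambda>m. of_rat a * (real m powi k * u m) + pv p m * (real m powi (k + 1) * u m))"
    by (intro tail_in_span_add tail_in_span_cmult assms pCons)
  moreover have "exp_decay (\<lambda>m. pv (pCons a p) m * (real m powi k * u m))"
    by (intro exp_decay_pv_mult exp_decay_mult_powi assms)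
  ultimately show ?case
    by (rule tail_in_span_cong) (simp add: power_int_add algebra_simps del: of_nat_Suc)
qed

text \<open>The rising factorials \<open>(T + 1) \<cdots> (T + k)\<close>, for which both recursions below close up.\<close>

fun rising :: "nat \<Rightarrow> rat poly" where
  "rising 0 = 1"
| "rising (Suc k) = rising k * [:of_nat (Suc k), 1:]"

lemma poly_rising_pred: "poly (rising (Suc k)) (x - 1) = x * poly (rising k) x"
proof (induction k)
  case (Suc k)
  have "poly (rising (Suc (Suc k))) (x - 1) = poly (rising (Suc k)) (x - 1) * (of_nat (Suc k) + x)"
    by (subst rising.simps(2)) (simp del: rising.simps add: algebra_simps)
  then show ?case
    unfolding Suc by (simp add: algebra_simps)
qed simp

text \<open>The factor \<open>Suc m\<close> is the one that the central binomial recursion needs to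
  express \<open>cbs [] m\<close> through \<open>cbs [] (Suc m)\<close> without a
  denominator.\<close>

lemma pv_rising_shift: "pv (rising (Suc k)) m = real (Suc m) * pv (rising k) (Suc m)"
  using poly_rising_pred[of k "of_nat (Suc m)"]
  by (simp add: pv_def of_rat_mult of_rat_add del: rising.simps)

lemma pv_rising_Suc: "pv (rising (Suc k)) m = pv (rising k) m * (real m + real (Suc k))"
  by (simp add: of_rat_add algebra_simps)

text \<open>Rising factorials span all polynomials. The induction on \<open>p\<close> carries a
  factor \<open>rising k\<close> and uses
  \<open>T * rising k = rising (k + 1) - (k + 1) * rising k\<close>.\<close>

lemma tail_in_span_pv_mult:
  assumes "\<And>k. tail_in_span (\<lambda>m. pv (rising k) m * u m)"
  shows "tail_in_span (\<lambda>m. pv p m * u m)"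
proof -
  have "tail_in_span (\<lambda>m. pv (rising k) m * pv p m * u m)" for k
  proof (induction p arbitrary: k)
    case 0
    show ?case using tail_in_span_zero by simp
  next
    case (pCons a p)
    have "tail_in_span (\<lambda>m. of_rat a * (pv (rising k) m * u m) + (pv (rising (Suc k)) m * pv p m * u m +
        of_rat (- of_nat (Suc k)) * (pv (rising k) m * pv p m * u m)))"
      by (intro tail_in_span_add tail_in_span_cmult assms pCons)
    then show ?case
      unfolding pv_rising_Suc of_rat_minus of_rat_of_nat_eq by (simp add: algebra_simps)
  qed
  from this[of 0] show ?thesis by simp
qed

text \<open>For negative \<open>k\<close> the tail is itself the generator with the positive entry
  \<open>-k\<close> put in front; otherwise the power is a polynomial.\<close>

lemma tail_in_span_powi_mult:
  assumes "b \<in> compositions" "\<And>j. tail_in_span (\<lambda>m. pv (rising j) m * cbs (map int b) m)"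
  shows "tail_in_span (\<lambda>m. real m powi k * cbs (map int b) m)"
proof (cases "k \<ge> 0")
  case True
  then show ?thesis
    using tail_in_span_pv_mult[OF assms(2), of "monom 1 (nat k)"] by (simp add: pv_monom power_int_def)
next
  case False
  define s where "s = nat (- k)"
  have "s # b \<in> compositions"
    using assms(1) False by (auto simp: compositions_def s_def)
  from poly_span_base[OF this, of 1] have "cbs (map int (s # b)) \<in> poly_span"
    by (simp del: cbs.simps)
  moreover have "cbs (map int (s # b)) = tail (\<lambda>m. real m powi k * cbs (map int b) m)"
    using False by (simp add: s_def)
  ultimately show ?thesis
    by (simp add: tail_in_span_def exp_decay_mult_powi exp_decay_cbs)
qed

text \<open>With \<open>M = m + 1\<close>, the difference of \<open>rising k * cbs []\<close>
  between \<open>m\<close> and \<open>M\<close> has leading factor \<open>4 - 1 = 3\<close>, so a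
  third of that product telescopes up to a remainder of lower order.\<close>

lemma tail_in_span_rising_Nil: "tail_in_span (\<lambda>m. pv (rising k) m * cbs [] m)"
proof (induction k)
  case 0
  have nil: "[] \<in> compositions" and one: "[1] \<in> compositions"
    by (auto simp: compositions_def)
  show ?case
  proof (rule tail_in_span_telescope)
    show "exp_decay (\<lambda>m. pv (rising 0) m * cbs [] m)"
      by (intro exp_decay_pv_mult exp_decay_cbs)
    show "exp_decay (\<lambda>m. of_rat (1/3) * cbs [] m)"
      by (intro exp_decay_cmult exp_decay_cbs)
    show "(\<lambda>m. of_rat (1/3) * cbs [] m) \<in> poly_span"
      using poly_span_cmult[OF poly_span_base[OF nil, of 1]] by (simp del: cbs.simps)
    \<comment> \<open>For \<open>k = 0\<close> the remainder is \<open>2 / (3 * M)\<close> times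
      \<open>cbs []\<close>, and the tail of \<open>cbs [] / M\<close> is the generator for
      \<open>[1]\<close>.\<close>
    have "cbs (map int [1]) \<in> poly_span"
      using poly_span_base[OF one, of 1] by (simp del: cbs.simps)
    then have "tail_in_span (\<lambda>m. real m powi (-1) * cbs [] m)"
      unfolding tail_in_span_def
      by (intro conjI exp_decay_mult_powi exp_decay_cbs) (simp del: cbs.simps(1))
    then show "tail_in_span (\<lambda>m. of_rat (2/3) * (real m powi (-1) * cbs [] m))"
      by (rule tail_in_span_cmult)
    fix m
    have "cbs [] m = (4 * real (Suc m) - 2) * cbs [] (Suc m) / real (Suc m)"
      using cbs_Nil_rec[of m] by (simp add: field_simps del: cbs.simps of_nat_Suc)
    then show "pv (rising 0) (Suc m) * cbs [] (Suc m) =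
        of_rat (1/3) * cbs [] m - of_rat (1/3) * cbs [] (Suc m) +
        of_rat (2/3) * (real (Suc m) powi (-1) * cbs [] (Suc m))"
      by (simp add: of_rat_divide field_simps power_int_minus del: cbs.simps of_nat_Suc)
  qed
next
  case (Suc k)
  have nil: "[] \<in> compositions"
    by (auto simp: compositions_def)
  show ?case
  proof (rule tail_in_span_telescope)
    show "exp_decay (\<lambda>m. pv (rising (Suc k)) m * cbs [] m)"
      by (intro exp_decay_pv_mult exp_decay_cbs)
    show "exp_decay (\<lambda>m. of_rat (1/3) * (pv (rising (Suc k)) m * cbs [] m))"
      by (intro exp_decay_cmult exp_decay_pv_mult exp_decay_cbs)
    show "(\<lambda>m. of_rat (1/3) * (pv (rising (Suc k)) m * cbs [] m)) \<in> poly_span"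
      using poly_span_cmult[OF poly_span_base[OF nil, of "rising (Suc k)"], of "1/3"]
      by (simp only: list.map)
    \<comment> \<open>The constant is
      \<open>3 * (M + k + 1) - ((4 * M - 2) - (M + k + 1)) = 4 * k + 6\<close>.\<close>
    show "tail_in_span (\<lambda>m. of_rat (of_nat (4 * k + 6) / 3) * (pv (rising k) m * cbs [] m))"
      by (intro tail_in_span_cmult Suc)
    fix m
    define M P c where "M = real (Suc m)" and "P = pv (rising k) (Suc m)" and "c = cbs [] (Suc m)"
    have 1: "pv (rising (Suc k)) m * cbs [] m = P * ((4 * M - 2) * c)"
      using cbs_Nil_rec[of m] unfolding pv_rising_shift M_def P_def c_def
      by (simp del: cbs.simps of_nat_Suc add: mult_ac)
    have 2: "pv (rising (Suc k)) (Suc m) = P * (M + real k + 1)"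
      unfolding pv_rising_Suc P_def M_def by simp
    show "pv (rising (Suc k)) (Suc m) * cbs [] (Suc m) =
        of_rat (1/3) * (pv (rising (Suc k)) m * cbs [] m) -
        of_rat (1/3) * (pv (rising (Suc k)) (Suc m) * cbs [] (Suc m)) +
        of_rat (of_nat (4 * k + 6) / 3) * (pv (rising k) (Suc m) * cbs [] (Suc m))"
      unfolding 1 unfolding 2 unfolding P_def[symmetric] c_def[symmetric]
      by (simp add: of_rat_divide of_rat_add of_rat_mult field_simps)
  qed
qed

text \<open>In the summation by parts, differencing \<open>cbs (s # b)\<close> leaves a power times
  \<open>cbs b\<close>, so the remainder has one entry fewer and falls under
  \<open>IH\<close>.\<close>

lemma tail_in_span_rising_Cons:
  assumes comp: "s # b \<in> compositions"
    and IH: "\<And>k. tail_in_span (\<lambda>m. real m powi k * cbs (map int b) m)"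
  shows "tail_in_span (\<lambda>m. pv (rising k) m * cbs (map int (s # b)) m)"
proof (rule tail_in_span_telescope)
  define u where "u = cbs (map int (s # b))"
  \<comment> \<open>The difference of \<open>rising (k + 1)\<close> between \<open>m\<close> and
    \<open>m + 1\<close> is \<open>(k + 1) * rising k\<close> at \<open>m + 1\<close>, so its
    discrete antiderivative needs the factor \<open>1 / (k + 1)\<close>.\<close>
  define c :: rat where "c = 1 / of_nat (Suc k)"
  show "exp_decay (\<lambda>m. pv (rising k) m * u m)"
    unfolding u_def by (intro exp_decay_pv_mult exp_decay_cbs)
  show "exp_decay (\<lambda>m. of_rat (- c) * (pv (rising (Suc k)) m * u m))"
    unfolding u_def by (intro exp_decay_cmult exp_decay_pv_mult exp_decay_cbs)
  show "(\<lambda>m. of_rat (- c) * (pv (rising (Suc k)) m * u m)) \<in> poly_span"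
    unfolding u_def by (intro poly_span_cmult poly_span_base comp)
  show "tail_in_span (\<lambda>m. of_rat c * (pv ([:0, 1:] * rising k) m * (real m powi (- int s) * cbs (map int b) m)))"
    by (intro tail_in_span_cmult tail_in_span_pv_powi_mult IH exp_decay_cbs)
  fix m
  define M P where "M = real (Suc m)" and "P = pv (rising k) (Suc m)"
  define v where "v = real (Suc m) powi (- int s) * cbs (map int b) (Suc m)"
  have 1: "u m = u (Suc m) + v"
    unfolding u_def v_def list.map by (rule cbs_Cons_Suc)
  have 2: "pv (rising (Suc k)) m = M * P"
    unfolding M_def P_def by (rule pv_rising_shift)
  have 3: "pv (rising (Suc k)) (Suc m) = P * (M + real (Suc k))"
    unfolding M_def P_def by (rule pv_rising_Suc)
  have 4: "pv ([:0, 1:] * rising k) (Suc m) = M * P"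
    unfolding M_def P_def by simp
  have c: "(of_rat c :: real) = 1 / real (Suc k)"
    unfolding c_def by (simp add: of_rat_divide of_rat_add)
  show "pv (rising k) (Suc m) * u (Suc m) =
      of_rat (- c) * (pv (rising (Suc k)) m * u m) -
      of_rat (- c) * (pv (rising (Suc k)) (Suc m) * u (Suc m)) +
      of_rat c * (pv ([:0, 1:] * rising k) (Suc m) * (real (Suc m) powi (- int s) * cbs (map int b) (Suc m)))"
    unfolding 2 3 4 1 unfolding P_def[symmetric] v_def[symmetric] of_rat_minus c
    by (simp add: field_simps del: of_nat_Suc)
qed

lemma tail_in_span_powi_cbs:
  assumes "b \<in> compositions"
  shows "tail_in_span (\<lambda>m. real m powi k * cbs (map int b) m)"
  using assms
proof (induction b arbitrary: k)
  case Nil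
  show ?case
    by (rule tail_in_span_powi_mult[OF Nil]) (use tail_in_span_rising_Nil in simp)
next
  case (Cons s b)
  have "b \<in> compositions"
    using Cons.prems by (simp add: compositions_def)
  then show ?case
    by (intro tail_in_span_powi_mult[OF Cons.prems] tail_in_span_rising_Cons[OF Cons.prems] Cons.IH)
qed

lemma tail_in_span_powi_poly_span:
  assumes "u \<in> poly_span"
  shows "tail_in_span (\<lambda>m. real m powi k * u m)"
  using assms
proof induction
  case zero
  show ?case using tail_in_span_zero by simp
next
  case (plus b u p)
  have "tail_in_span (\<lambda>m. pv p m * (real m powi k * cbs (map int b) m) + real m powi k * u m)"
    by (intro tail_in_span_add tail_in_span_pv_powi_mult tail_in_span_powi_cbs exp_decay_cbs plus)
  then show ?case
    by (simp add: algebra_simps)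
qed

text \<open>Each further entry, of whatever sign, is one tail sum of a power times an element of the
  module.\<close>

lemma cbs_in_poly_span: "cbs t \<in> poly_span"
proof (induction t)
  case Nil
  show ?case
    using poly_span_base[of "[]" 1] by (simp add: compositions_def)
next
  case (Cons s t)
  then show ?case
    using tail_in_span_powi_poly_span[OF Cons, of "-s"] by (simp add: tail_in_span_def)
qed

section \<open>Transfer to complex coefficients, existence and uniqueness\<close>

lemma of_rat_poly_complex:
  "(of_rat (poly p (of_nat n)) :: complex) = poly (map_poly of_rat p) (of_nat n)"
  by (induction p) (simp_all add: map_poly_pCons of_rat_add of_rat_mult)

lemma complex_of_real_of_rat: "complex_of_real (of_rat q) = of_rat q"
  by (cases q) (simp add: of_rat_rat)

lemma cbs_linearly_independent:
  assumes "finite D" "D \<subseteq> compositions"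
    and rel: "\<And>n. (\<Sum>b\<in>D. pv (d b) n * cbs (map int b) n) = 0"
    and "b \<in> D"
  shows "d b = 0"
proof -
  \<comment> \<open>All suffixes are added to make the index set closed under \<open>tl\<close>; the
    new lists get coefficient 0.\<close>
  define B where "B = (\<Union>b\<in>D. (\<lambda>k. drop k b) ` {..length b})"
  define f where "f = (\<lambda>b. map_poly (of_rat :: rat \<Rightarrow> complex) (if b \<in> D then d b else 0))"
  define u where "u = (\<lambda>b n. complex_of_real (cbs (map int b) n))"
  have "finite B"
    using assms(1) by (simp add: B_def)
  have "D \<subseteq> B"
  proof
    fix x assume "x \<in> D"
    then show "x \<in> B"
      unfolding B_def by (intro UN_I[of x] image_eqI[of _ _ 0]) auto
  qed
  have "\<forall>b\<in>B. f b = 0"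
  proof (rule linearly_independent[where u = u and N = 0])
    show "u [] n \<noteq> 0" for n
      by (simp add: u_def)
    show "of_nat (Suc n) * u [] n = (4 * of_nat (Suc n) - 2) * u [] (Suc n)" for n
      using arg_cong[OF cbs_Nil_rec[of n], of complex_of_real]
      by (simp add: u_def del: cbs.simps)
    show "u (s # b) n = u (s # b) (Suc n) + u b (Suc n) / of_nat (Suc n) ^ s" for s b n
      unfolding u_def list.map
      by (subst cbs_Cons_Suc) (simp add: power_int_minus divide_inverse mult.commute del: cbs.simps)
    show "B \<subseteq> compositions"
      using assms(2) by (auto simp: B_def compositions_def dest!: in_set_dropD)
    show "tl x \<in> B" if "x \<in> B" for x
    proof -
      obtain b k where "b \<in> D" "x = drop k b"
        using \<open>x \<in> B\<close> by (auto simp: B_def)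
      \<comment> \<open>The minimum handles \<open>k = length b\<close>, where the suffix is empty
        and equals its own tail.\<close>
      moreover have "tl (drop k b) = drop (min (Suc k) (length b)) b"
        by (auto simp: min_def drop_Suc tl_drop)
      ultimately show ?thesis
        unfolding B_def by (intro UN_I[of b] image_eqI[of _ _ "min (Suc k) (length b)"]) auto
    qed
    show "(\<Sum>b\<in>B. poly (f b) (of_nat n) * u b n) = 0" for n
    proof -
      have "(\<Sum>b\<in>B. poly (f b) (of_nat n) * u b n) = (\<Sum>b\<in>D. poly (f b) (of_nat n) * u b n)"
        using \<open>finite B\<close> \<open>D \<subseteq> B\<close> by (intro sum.mono_neutral_right) (auto simp: f_def)
      also have "\<dots> = complex_of_real (\<Sum>b\<in>D. pv (d b) n * cbs (map int b) n)"
        by (simp add: f_def u_def pv_def complex_of_real_of_rat of_rat_poly_complex)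
      finally show ?thesis
        by (simp add: rel)
    qed
  qed fact
  then have "map_poly (of_rat :: rat \<Rightarrow> complex) (d b) = 0"
    using \<open>D \<subseteq> B\<close> \<open>b \<in> D\<close> unfolding f_def by force
  then show ?thesis
    by (simp add: poly_eq_iff coeff_map_poly)
qed

lemma cb_sigma_of_nat: "cb_sigma (map of_nat b) n = of_real (cbs (map int (rev b)) n)"
  using cb_sigma_eq_cbs[of "map int b" n] by (simp add: comp_def rev_map)

lemma cb_combination_eq:
  "(\<Sum>b\<in>B. of_rat (poly (f b) (of_nat n)) * cb_sigma (map of_nat b) n) =
    of_real (\<Sum>b\<in>rev ` B. pv (f (rev b)) n * cbs (map int b) n)"
  by (subst sum.reindex)
    (auto simp: inj_on_def pv_def complex_of_real_of_rat cb_sigma_of_nat)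

theorem theorem3:
  fixes a :: "int list"
  shows "\<exists>!f :: nat list \<Rightarrow> rat poly.
           (\<forall>b. b \<notin> compositions \<longrightarrow> f b = 0) \<and>
           finite {b \<in> compositions. f b \<noteq> 0} \<and>
           (\<forall>n :: nat. cb_sigma (map of_int a) n =
              (\<Sum>b\<in>{b \<in> compositions. f b \<noteq> 0}.
                 of_rat (poly (f b) (of_nat n)) * cb_sigma (map of_nat b) n))"
proof (rule ex_ex1I)
  obtain g where g: "\<forall>b. b \<notin> compositions \<longrightarrow> g b = 0" "finite {b. g b \<noteq> 0}"
    "\<And>n. cbs (rev a) n = (\<Sum>b | g b \<noteq> 0. pv (g b) n * cbs (map int b) n)"
    using poly_span_explicit[OF cbs_in_poly_span[of "rev a"]] by blast
  \<comment> \<open>\<open>cbs\<close> reads lists from their last entry, so its coefficients belong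
    to the reversed compositions.\<close>
  define f where "f = (\<lambda>b. g (rev b))"
  have f: "\<forall>b. b \<notin> compositions \<longrightarrow> f b = 0"
    using g(1) by (simp add: f_def compositions_def)
  then have supp: "{b \<in> compositions. f b \<noteq> 0} = {b. f b \<noteq> 0}"
    by auto
  have rev: "rev ` {b. f b \<noteq> 0} = {b. g b \<noteq> 0}"
  proof (intro set_eqI iffI)
    fix b assume "b \<in> {b. g b \<noteq> 0}"
    then show "b \<in> rev ` {b. f b \<noteq> 0}"
      by (intro image_eqI[of _ _ "rev b"]) (auto simp: f_def)
  qed (auto simp: f_def)
  then have "finite {b. f b \<noteq> 0}"
    using g(2) by (metis finite_imageD inj_on_rev)
  moreover have "f (rev b) = g b" for b
    by (simp add: f_def)
  ultimately show "\<exists>f :: nat list \<Rightarrow> rat poly.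
           (\<forall>b. b \<notin> compositions \<longrightarrow> f b = 0) \<and>
           finite {b \<in> compositions. f b \<noteq> 0} \<and>
           (\<forall>n :: nat. cb_sigma (map of_int a) n =
              (\<Sum>b\<in>{b \<in> compositions. f b \<noteq> 0}.
                 of_rat (poly (f b) (of_nat n)) * cb_sigma (map of_nat b) n))"
    using f by (intro exI[of _ f]) (simp add: supp cb_combination_eq rev cb_sigma_eq_cbs g(3))
next
  fix f g :: "nat list \<Rightarrow> rat poly"
  assume f: "(\<forall>b. b \<notin> compositions \<longrightarrow> f b = 0) \<and>
           finite {b \<in> compositions. f b \<noteq> 0} \<and>
           (\<forall>n :: nat. cb_sigma (map of_int a) n =
              (\<Sum>b\<in>{b \<in> compositions. f b \<noteq> 0}.
                 of_rat (poly (f b) (of_nat n)) * cb_sigma (map of_nat b) n))"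
    and g: "(\<forall>b. b \<notin> compositions \<longrightarrow> g b = 0) \<and>
           finite {b \<in> compositions. g b \<noteq> 0} \<and>
           (\<forall>n :: nat. cb_sigma (map of_int a) n =
              (\<Sum>b\<in>{b \<in> compositions. g b \<noteq> 0}.
                 of_rat (poly (g b) (of_nat n)) * cb_sigma (map of_nat b) n))"
  \<comment> \<open>On the union of both supports the two expansions become one relation between
    finitely many generators.\<close>
  define D where "D = {b \<in> compositions. f b \<noteq> 0} \<union> {b \<in> compositions. g b \<noteq> 0}"
  have D: "finite D" "D \<subseteq> compositions"
    using f g by (auto simp: D_def)
  have ext: "(\<Sum>b\<in>{b \<in> compositions. h b \<noteq> 0}. of_rat (poly (h b) (of_nat n)) * cb_sigma (map of_nat b) n) =
      (\<Sum>b\<in>D. of_rat (poly (h b) (of_nat n)) * cb_sigma (map of_nat b) n)"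
    if "h = f \<or> h = g" for h n
    using D that by (intro sum.mono_neutral_left) (auto simp: D_def)
  have "(\<Sum>b\<in>rev ` D. pv (f (rev b) - g (rev b)) n * cbs (map int b) n) = 0" for n
  proof -
    have "complex_of_real (\<Sum>b\<in>rev ` D. pv (f (rev b)) n * cbs (map int b) n) =
        of_real (\<Sum>b\<in>rev ` D. pv (g (rev b)) n * cbs (map int b) n)"
      unfolding cb_combination_eq[symmetric] using f g ext[of f] ext[of g] by metis
    then show ?thesis
      unfolding of_real_eq_iff by (simp add: left_diff_distrib sum_subtractf)
  qed
  moreover have "finite (rev ` D)" "rev ` D \<subseteq> compositions"
    using D by (simp, force simp: compositions_def)
  ultimately have "f (rev (rev b)) - g (rev (rev b)) = 0" if "b \<in> D" for b
    using cbs_linearly_independent[of "rev ` D" "\<lambda>b. f (rev b) - g (rev b)" "rev b"] that by blast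
  then have "f b = g b" if "b \<in> D" for b
    using that by simp
  moreover have "f b = g b" if "b \<notin> D" for b
    using that f g by (auto simp: D_def)
  ultimately show "f = g" by blast
qed

end
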